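(* Let $((A,\circ),(B,\cdot),\rho_\circ,\rho_\cdot)$ be a matched pair of commutative associative algebras, let $((A_h,\circ_h),(B_h,\cdot_h),l_{\circ_h},r_{\circ_h},l_{\cdot_h},r_{\cdot_h})$ be an associative matched pair deformation of it, and let $((A,\{,\},\circ),(B,[,],\cdot),\rho_{\{,\}},\rho_\circ,\rho_{[,]},\rho_\cdot)$ be the QCL. Then $((A,\{,\},\circ),(B,[,],\cdot),\rho_{\{,\}},\rho_\circ,\rho_{[,]},\rho_\cdot)$ is a matched pair of Poisson algebras. Moreover, the QCL of the associative deformation $A_h\bowtie_{l_{\cdot_h},r_{\cdot_h}}^{l_{\circ_h},r_{\circ_h}}B_h$ of the commutative associative algebra $A\bowtie_{\rho_\cdot}^{\rho_\circ}B$ is exactly the Poisson algebra $A\bowtie_{\rho_{[,]},\rho_\cdot}^{\rho_{\{,\}},\rho_\circ}B$.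
   Context: Conventions. $\mathbf{k}$ is a field of characteristic $0$, $\mathbf{K}=\mathbf{k}[[h]]$; vector spaces and algebras are over $\mathbf{k}$, not necessarily unital. For a vector space $V$, $V_h:=V[[h]]$; $V\subset V_h$ as constant series; $\equiv\pmod{h}$ means equality modulo $hV_h$. A topologically free $\mathbf{K}$-module is one isomorphic to some $V[[h]]$; a topologically free associative algebra is such a module with an associative $\mathbf{K}$-bilinear operation. Associative deformation of an associative algebra $(A,\circ)$: a topologically free associative algebra $(A_h,\circ_h)$, $A_h=A[[h]]$, with $x\circ_h y\equiv x\circ y\pmod h$ for $x,y\in A$. If $\circ$ is commutative, its quasiclassical limit (QCL) is $(A,\{,\},\circ)$, where $\{,\}:A\times A\to A$ is determined by $\{x,y\}\equiv\frac{x\circ_h y-y\circ_h x}{h}\pmod h$ (it is well known that this is a Poisson algebra). Matched pair of associative algebras $((A,\circ),(B,\cdot),l_\circ,r_\circ,l_\cdot,r_\cdot)$: associative algebras $(A,\circ)$, $(B,\cdot)$ and linear maps $l_\circ,r_\circ:A\to\mathrm{End}(B)$, $l_\cdot,r_\cdot:B\to\mathrm{End}(A)$ such that the operation $(x,u)\odot(y,v)=(x\circ y+l_\cdot(u)y+r_\cdot(v)x,\ l_\circ(x)v+r_\circ(y)u+u\cdot v)$ on $A\oplus B$ is associative; then $(A\oplus B,\odot)$ is denoted $A\bowtie_{l_\cdot,r_\cdot}^{l_\circ,r_\circ}B$. If $(A,\circ)$, $(B,\cdot)$ and $A\bowtie_{l_\cdot,r_\cdot}^{l_\circ,r_\circ}B$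 are commutative, then $l_\circ=r_\circ=:\rho_\circ$ and $l_\cdot=r_\cdot=:\rho_\cdot$; one writes $((A,\circ),(B,\cdot),\rho_\circ,\rho_\cdot)$, $A\bowtie_{\rho_\cdot}^{\rho_\circ}B$ and speaks of a matched pair of commutative associative algebras. Matched pair of topologically free associative algebras: the same with $(A_h,\circ_h),(B_h,\cdot_h)$ topologically free associative algebras and all maps $\mathbf{K}$-linear (values in $\mathrm{End}_{\mathbf{K}}$); the algebra on $A_h\oplus B_h$ is denoted $A_h\bowtie_{l_{\cdot_h},r_{\cdot_h}}^{l_{\circ_h},r_{\circ_h}}B_h$. Identify $A_h\oplus B_h$ with $(A\oplus B)_h$. Associative matched pair deformation of $((A,\circ),(B,\cdot),l_\circ,r_\circ,l_\cdot,r_\cdot)$: a matched pair of topologically free associative algebras, with $A_h=A[[h]]$, $B_h=B[[h]]$, such that $A_h\bowtie_{l_{\cdot_h},r_{\cdot_h}}^{l_{\circ_h},r_{\circ_h}}B_h$ is an associative deformation of $A\bowtie_{l_\cdot,r_\cdot}^{l_\circ,r_\circ}B$. QCL of an associative matched pair deformation of $((A,\circ),(B,\cdot),\rho_\circ,\rho_\cdot)$: $((A,\{,\},\circ),(B,[,],\cdot),\rho_{\{,\}},\rho_\circ,\rho_{[,]},\rho_\cdot)$, where $(A,\{,\},\circ)$, $(B,[,],\cdot)$ are the QCLs of $(A_h,\circ_h)$, $(B_h,\cdot_h)$, and $\rho_{\{,\}}:A\to\mathrm{End}(B)$, $\rho_{[,]}:B\to\mathrm{End}(A)$ are determined by $\rho_{\{,\}}(x)v\equiv\frac{l_{\circ_h}(x)v-r_{\circ_h}(x)v}{h}\pmod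 h$ and $\rho_{[,]}(v)x\equiv\frac{l_{\cdot_h}(v)x-r_{\cdot_h}(v)x}{h}\pmod h$ for $x\in A,v\in B$. Poisson algebra $(P,\{,\},\circ)$: a Lie algebra $(P,\{,\})$ and a commutative associative algebra $(P,\circ)$ with $\{x,y\circ z\}=\{x,y\}\circ z+y\circ\{x,z\}$. Matched pair of Poisson algebras $((P,\{,\},\circ),(Q,[,],\cdot),\rho_{\{,\}},\rho_\circ,\rho_{[,]},\rho_\cdot)$: Poisson algebras and linear maps $\rho_{\{,\}},\rho_\circ:P\to\mathrm{End}(Q)$, $\rho_{[,]},\rho_\cdot:Q\to\mathrm{End}(P)$ such that $P\oplus Q$ with $\llbracket(x,u),(y,v)\rrbracket=(\{x,y\}+\rho_{[,]}(u)y-\rho_{[,]}(v)x,\ \rho_{\{,\}}(x)v-\rho_{\{,\}}(y)u+[u,v])$ and $(x,u)\odot(y,v)=(x\circ y+\rho_\cdot(u)y+\rho_\cdot(v)x,\ \rho_\circ(x)v+\rho_\circ(y)u+u\cdot v)$ is a Poisson algebra, denoted $P\bowtie_{\rho_{[,]},\rho_\cdot}^{\rho_{\{,\}},\rho_\circ}Q$. *)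

theory Defs
  imports
    "HOL-Analysis.Product_Vector"
    "HOL-Computational_Algebra.Formal_Power_Series"
begin

text \<open>
  A module over a commutative ring is a type together with a scalar multiplication satisfying the
  locale \<open>module\<close>; over a field this is the same as \<open>vector_space\<close>
  (\<open>module_iff_vector_space\<close>). The ground ring is kept general so that the same definitions serve for
  algebras over a field \<open>'k\<close> and over the ring \<open>'k fps\<close> of power series in \<open>h\<close>.
  Algebras are not assumed to be unital.
\<close>

definition bilinear_map ::
  "('r::comm_ring_1 \<Rightarrow> 'a::ab_group_add \<Rightarrow> 'a) \<Rightarrow> ('r \<Rightarrow> 'b::ab_group_add \<Rightarrow> 'b) \<Rightarrow>
   ('r \<Rightarrow> 'c::ab_group_add \<Rightarrow> 'c) \<Rightarrow> ('a \<Rightarrow> 'b \<Rightarrow> 'c) \<Rightarrow> bool" where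
  "bilinear_map s1 s2 s3 f \<longleftrightarrow>
     (\<forall>x. module_hom s2 s3 (f x)) \<and> (\<forall>y. module_hom s1 s3 (\<lambda>x. f x y))"

locale assoc_algebra = module scale
  for scale :: "'r::comm_ring_1 \<Rightarrow> 'a::ab_group_add \<Rightarrow> 'a" +
  fixes mul :: "'a \<Rightarrow> 'a \<Rightarrow> 'a"
  assumes mul_bilinear: "bilinear_map scale scale scale mul"
    and mul_assoc: "mul (mul x y) z = mul x (mul y z)"

locale comm_assoc_algebra = assoc_algebra scale mul
  for scale :: "'r::comm_ring_1 \<Rightarrow> 'a::ab_group_add \<Rightarrow> 'a" and mul +
  assumes mul_comm: "mul x y = mul y x"

locale lie_algebra = module scale
  for scale :: "'r::comm_ring_1 \<Rightarrow> 'a::ab_group_add \<Rightarrow> 'a" +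
  fixes br :: "'a \<Rightarrow> 'a \<Rightarrow> 'a"
  assumes br_bilinear: "bilinear_map scale scale scale br"
    and br_self: "br x x = 0"
    and jacobi: "br x (br y z) + br y (br z x) + br z (br x y) = 0"

locale poisson_algebra = lie_algebra scale br + comm_assoc_algebra scale mul
  for scale :: "'r::comm_ring_1 \<Rightarrow> 'a::ab_group_add \<Rightarrow> 'a" and br mul +
  assumes leibniz: "br x (mul y z) = mul (br x y) z + mul y (br x z)"


section \<open>Matched pairs\<close>

definition assoc_bowtie ::
  "('a::ab_group_add \<Rightarrow> 'a \<Rightarrow> 'a) \<Rightarrow> ('b::ab_group_add \<Rightarrow> 'b \<Rightarrow> 'b) \<Rightarrow>
   ('a \<Rightarrow> 'b \<Rightarrow> 'b) \<Rightarrow> ('a \<Rightarrow> 'b \<Rightarrow> 'b) \<Rightarrow> ('b \<Rightarrow> 'a \<Rightarrow> 'a) \<Rightarrow> ('b \<Rightarrow> 'a \<Rightarrow> 'a) \<Rightarrow>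
   'a \<times> 'b \<Rightarrow> 'a \<times> 'b \<Rightarrow> 'a \<times> 'b" where
  "assoc_bowtie mA mB lA rA lB rB = (\<lambda>(x, u) (y, v).
     (mA x y + lB u y + rB v x, lA x v + rA y u + mB u v))"

text \<open>
  A linear map \<open>A \<rightarrow> End(B)\<close> is given in curried form, as a bilinear map \<open>A \<times> B \<rightarrow> B\<close>.
\<close>

definition assoc_matched_pair ::
  "('r::comm_ring_1 \<Rightarrow> 'a::ab_group_add \<Rightarrow> 'a) \<Rightarrow> ('a \<Rightarrow> 'a \<Rightarrow> 'a) \<Rightarrow>
   ('r \<Rightarrow> 'b::ab_group_add \<Rightarrow> 'b) \<Rightarrow> ('b \<Rightarrow> 'b \<Rightarrow> 'b) \<Rightarrow>
   ('a \<Rightarrow> 'b \<Rightarrow> 'b) \<Rightarrow> ('a \<Rightarrow> 'b \<Rightarrow> 'b) \<Rightarrow> ('b \<Rightarrow> 'a \<Rightarrow> 'a) \<Rightarrow> ('b \<Rightarrow> 'a \<Rightarrow> 'a) \<Rightarrow> bool" where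
  "assoc_matched_pair sA mA sB mB lA rA lB rB \<longleftrightarrow>
     assoc_algebra sA mA \<and> assoc_algebra sB mB \<and>
     bilinear_map sA sB sB lA \<and> bilinear_map sA sB sB rA \<and>
     bilinear_map sB sA sA lB \<and> bilinear_map sB sA sA rB \<and>
     (\<forall>p q r. assoc_bowtie mA mB lA rA lB rB (assoc_bowtie mA mB lA rA lB rB p q) r =
              assoc_bowtie mA mB lA rA lB rB p (assoc_bowtie mA mB lA rA lB rB q r))"

definition comm_matched_pair ::
  "('r::comm_ring_1 \<Rightarrow> 'a::ab_group_add \<Rightarrow> 'a) \<Rightarrow> ('a \<Rightarrow> 'a \<Rightarrow> 'a) \<Rightarrow>
   ('r \<Rightarrow> 'b::ab_group_add \<Rightarrow> 'b) \<Rightarrow> ('b \<Rightarrow> 'b \<Rightarrow> 'b) \<Rightarrow>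
   ('a \<Rightarrow> 'b \<Rightarrow> 'b) \<Rightarrow> ('b \<Rightarrow> 'a \<Rightarrow> 'a) \<Rightarrow> bool" where
  "comm_matched_pair sA mA sB mB rhoA rhoB \<longleftrightarrow>
     assoc_matched_pair sA mA sB mB rhoA rhoA rhoB rhoB \<and>
     comm_assoc_algebra sA mA \<and> comm_assoc_algebra sB mB \<and>
     comm_assoc_algebra (module_prod.scale sA sB) (assoc_bowtie mA mB rhoA rhoA rhoB rhoB)"

text \<open>
  The Poisson algebra structure on \<open>P \<times> Q\<close>, as the pair of its Lie bracket and its product.
\<close>

definition poisson_bowtie ::
  "('a::ab_group_add \<Rightarrow> 'a \<Rightarrow> 'a) \<Rightarrow> ('a \<Rightarrow> 'a \<Rightarrow> 'a) \<Rightarrow>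
   ('b::ab_group_add \<Rightarrow> 'b \<Rightarrow> 'b) \<Rightarrow> ('b \<Rightarrow> 'b \<Rightarrow> 'b) \<Rightarrow>
   ('a \<Rightarrow> 'b \<Rightarrow> 'b) \<Rightarrow> ('a \<Rightarrow> 'b \<Rightarrow> 'b) \<Rightarrow> ('b \<Rightarrow> 'a \<Rightarrow> 'a) \<Rightarrow> ('b \<Rightarrow> 'a \<Rightarrow> 'a) \<Rightarrow>
   ('a \<times> 'b \<Rightarrow> 'a \<times> 'b \<Rightarrow> 'a \<times> 'b) \<times> ('a \<times> 'b \<Rightarrow> 'a \<times> 'b \<Rightarrow> 'a \<times> 'b)" where
  "poisson_bowtie brP mP brQ mQ rho_brP rho_mP rho_brQ rho_mQ =
     ((\<lambda>(x, u) (y, v). (brP x y + rho_brQ u y - rho_brQ v x,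
                        rho_brP x v - rho_brP y u + brQ u v)),
      (\<lambda>(x, u) (y, v). (mP x y + rho_mQ u y + rho_mQ v x,
                        rho_mP x v + rho_mP y u + mQ u v)))"

definition poisson_matched_pair ::
  "('r::comm_ring_1 \<Rightarrow> 'a::ab_group_add \<Rightarrow> 'a) \<Rightarrow> ('a \<Rightarrow> 'a \<Rightarrow> 'a) \<Rightarrow> ('a \<Rightarrow> 'a \<Rightarrow> 'a) \<Rightarrow>
   ('r \<Rightarrow> 'b::ab_group_add \<Rightarrow> 'b) \<Rightarrow> ('b \<Rightarrow> 'b \<Rightarrow> 'b) \<Rightarrow> ('b \<Rightarrow> 'b \<Rightarrow> 'b) \<Rightarrow>
   ('a \<Rightarrow> 'b \<Rightarrow> 'b) \<Rightarrow> ('a \<Rightarrow> 'b \<Rightarrow> 'b) \<Rightarrow> ('b \<Rightarrow> 'a \<Rightarrow> 'a) \<Rightarrow> ('b \<Rightarrow> 'a \<Rightarrow> 'a) \<Rightarrow> bool" where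
  "poisson_matched_pair sP brP mP sQ brQ mQ rho_brP rho_mP rho_brQ rho_mQ \<longleftrightarrow>
     poisson_algebra sP brP mP \<and> poisson_algebra sQ brQ mQ \<and>
     bilinear_map sP sQ sQ rho_brP \<and> bilinear_map sP sQ sQ rho_mP \<and>
     bilinear_map sQ sP sP rho_brQ \<and> bilinear_map sQ sP sP rho_mQ \<and>
     (case poisson_bowtie brP mP brQ mQ rho_brP rho_mP rho_brQ rho_mQ of (br, mul) \<Rightarrow>
        poisson_algebra (module_prod.scale sP sQ) br mul)"


section \<open>Power series with coefficients in a vector space\<close>

text \<open>
  For a vector space with underlying type \<open>'a\<close>, the type \<open>'a fps\<close> is \<open>V[[h]]\<close>, with \<open>'k fps\<close> acting
  by the Cauchy product; \<open>fps_const\<close> is the inclusion of \<open>V\<close>, and \<open>fps_X\<close> is the scalar \<open>h\<close>.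
\<close>

definition fps_scale ::
  "('k::comm_ring_1 \<Rightarrow> 'a::ab_group_add \<Rightarrow> 'a) \<Rightarrow> 'k fps \<Rightarrow> 'a fps \<Rightarrow> 'a fps" where
  "fps_scale s c f = Abs_fps (\<lambda>n. \<Sum>i=0..n. s (fps_nth c i) (fps_nth f (n - i)))"

definition cong_h ::
  "('k::comm_ring_1 \<Rightarrow> 'a::ab_group_add \<Rightarrow> 'a) \<Rightarrow> 'a fps \<Rightarrow> 'a fps \<Rightarrow> bool" where
  "cong_h s f g \<longleftrightarrow> (\<exists>w. f - g = fps_scale s fps_X w)"

text \<open>
  The element \<open>x\<close> of \<open>V\<close> determined by \<open>f / h \<equiv> x (mod h)\<close>. It is only used for \<open>f\<close> divisible by \<open>h\<close>;
  see \<open>quot_h_eq\<close> below.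
\<close>

definition quot_h ::
  "('k::comm_ring_1 \<Rightarrow> 'a::ab_group_add \<Rightarrow> 'a) \<Rightarrow> 'a fps \<Rightarrow> 'a" where
  "quot_h s f = (THE x. \<exists>g. fps_scale s fps_X g = f \<and> cong_h s g (fps_const x))"

text \<open>The identification of \<open>A[[h]] \<times> B[[h]]\<close> with \<open>(A \<times> B)[[h]]\<close>, and its inverse.\<close>

definition fps_pair :: "'a fps \<times> 'b fps \<Rightarrow> ('a \<times> 'b) fps" where
  "fps_pair = (\<lambda>(f, g). Abs_fps (\<lambda>n. (fps_nth f n, fps_nth g n)))"

definition fps_unpair :: "('a \<times> 'b) fps \<Rightarrow> 'a fps \<times> 'b fps" where
  "fps_unpair F = (Abs_fps (\<lambda>n. fst (fps_nth F n)), Abs_fps (\<lambda>n. snd (fps_nth F n)))"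

definition transport_pair ::
  "('a fps \<times> 'b fps \<Rightarrow> 'a fps \<times> 'b fps \<Rightarrow> 'a fps \<times> 'b fps) \<Rightarrow>
   ('a \<times> 'b) fps \<Rightarrow> ('a \<times> 'b) fps \<Rightarrow> ('a \<times> 'b) fps" where
  "transport_pair m F G = fps_pair (m (fps_unpair F) (fps_unpair G))"

lemma fps_scale_X_nth:
  assumes "module s"
  shows "fps_nth (fps_scale s fps_X g) n = (if n = 0 then 0 else fps_nth g (n - 1))"
proof -
  interpret module s by fact
  have "(\<Sum>i=0..n. s (fps_nth fps_X i) (fps_nth g (n - i))) =
        (\<Sum>i=0..n. if i = 1 then fps_nth g (n - i) else 0)"
    by (intro sum.cong refl) (simp add: fps_X_def)
  then show ?thesis by (auto simp: fps_scale_def sum.delta)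
qed

lemma cong_h_iff:
  assumes "module s"
  shows "cong_h s f g \<longleftrightarrow> fps_nth f 0 = fps_nth g 0"
proof
  show "fps_nth f 0 = fps_nth g 0" if "cong_h s f g"
  proof -
    obtain w where "f - g = fps_scale s fps_X w" using \<open>cong_h s f g\<close> by (auto simp: cong_h_def)
    then have "fps_nth (f - g) 0 = fps_nth (fps_scale s fps_X w) 0" by simp
    then show ?thesis by (simp add: fps_scale_X_nth[OF assms])
  qed
  show "cong_h s f g" if "fps_nth f 0 = fps_nth g 0"
    unfolding cong_h_def
    by (rule exI[of _ "fps_shift 1 (f - g)"], rule fps_ext)
       (use that in \<open>simp add: fps_scale_X_nth[OF assms]\<close>)
qed

lemma quot_h_eq:
  assumes "module s" and "fps_nth f 0 = 0"
  shows "quot_h s f = fps_nth f 1"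
  unfolding quot_h_def
proof (rule the_equality)
  show "\<exists>g. fps_scale s fps_X g = f \<and> cong_h s g (fps_const (fps_nth f 1))"
    by (rule exI[of _ "fps_shift 1 f"])
       (use assms in \<open>auto intro!: fps_ext simp: fps_scale_X_nth cong_h_iff\<close>)
qed (use assms in \<open>auto simp: fps_scale_X_nth cong_h_iff\<close>)

lemma fps_pair_unpair [simp]: "fps_pair (fps_unpair F) = F"
  by (simp add: fps_pair_def fps_unpair_def fps_eq_iff)

lemma fps_unpair_pair [simp]: "fps_unpair (fps_pair p) = p"
  by (auto simp: fps_pair_def fps_unpair_def fps_eq_iff split: prod.splits)

lemma module_fps_scale:
  assumes "module s"
  shows "module (fps_scale s)"
proof -
  interpret module s by fact
  show ?thesis
  proof (unfold_locales)
    fix a b :: "'a fps" and x y :: "'b fps"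
    show "fps_scale s a (x + y) = fps_scale s a x + fps_scale s a y"
      by (rule fps_ext) (simp add: fps_scale_def scale_right_distrib sum.distrib)
    show "fps_scale s (a + b) x = fps_scale s a x + fps_scale s b x"
      by (rule fps_ext) (simp add: fps_scale_def scale_left_distrib sum.distrib)
    show "fps_scale s a (fps_scale s b x) = fps_scale s (a * b) x"
    proof (rule fps_ext)
      fix n
      have "fps_nth (fps_scale s (a * b) x) n =
          (\<Sum>k=0..n. \<Sum>i=0..k. s (fps_nth a i * fps_nth b (k - i)) (fps_nth x (n - k)))"
        by (simp add: fps_scale_def fps_mult_nth scale_sum_left)
      also have "\<dots> = (\<Sum>i=0..n. \<Sum>j=0..n - i. s (fps_nth a i * fps_nth b j) (fps_nth x (n - i - j)))"
        using fps_mult_assoc_lemma[where k = n and n = n and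
            f = "\<lambda>i j l. s (fps_nth a i * fps_nth b j) (fps_nth x l)"]
        by simp
      also have "\<dots> = fps_nth (fps_scale s a (fps_scale s b x)) n"
        by (simp add: fps_scale_def scale_sum_right)
      finally show "fps_nth (fps_scale s a (fps_scale s b x)) n = fps_nth (fps_scale s (a * b) x) n" ..
    qed
    show "fps_scale s 1 x = x"
    proof (rule fps_ext)
      fix n
      have "(\<Sum>i=0..n. s (fps_nth 1 i) (fps_nth x (n - i))) =
            (\<Sum>i=0..n. if i = 0 then fps_nth x (n - i) else 0)"
        by (intro sum.cong refl) simp
      then show "fps_nth (fps_scale s 1 x) n = fps_nth x n"
        by (simp add: fps_scale_def sum.delta)
    qed
  qed
qed

lemma fps_pair_linear:
  assumes "module sA" and "module sB"
  shows "module_hom (module_prod.scale (fps_scale sA) (fps_scale sB))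
           (fps_scale (module_prod.scale sA sB)) fps_pair"
proof -
  interpret AB: module_prod sA sB
    using assms by (simp add: module_prod_def module_pair_def)
  interpret ABh: module_prod "fps_scale sA" "fps_scale sB"
    using assms by (simp add: module_prod_def module_pair_def module_fps_scale)
  interpret R: module "fps_scale AB.scale"
    by (intro module_fps_scale AB.p.module_axioms)
  have sum_Pair: "(\<Sum>i\<in>I. (f i, g i)) = (sum f I, sum g I)"
    for I :: "nat set" and f :: "nat \<Rightarrow> 'b" and g :: "nat \<Rightarrow> 'c"
    by (rule prod_eqI) (simp_all add: fst_sum snd_sum)
  show ?thesis
    by unfold_locales
       (auto intro!: fps_ext simp: fps_pair_def fps_scale_def AB.scale_def ABh.scale_def
          sum_Pair split: prod.splits)
qed


section \<open>Deformations and quasiclassical limits\<close>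

definition assoc_deformation ::
  "('k::field \<Rightarrow> 'a::ab_group_add \<Rightarrow> 'a) \<Rightarrow> ('a \<Rightarrow> 'a \<Rightarrow> 'a) \<Rightarrow>
   ('a fps \<Rightarrow> 'a fps \<Rightarrow> 'a fps) \<Rightarrow> bool" where
  "assoc_deformation s mul mulh \<longleftrightarrow>
     assoc_algebra s mul \<and> assoc_algebra (fps_scale s) mulh \<and>
     (\<forall>x y. cong_h s (mulh (fps_const x) (fps_const y)) (fps_const (mul x y)))"

text \<open>
  The quasiclassical limit of a deformation \<open>mulh\<close> of a commutative algebra with product \<open>mul\<close>,
  as the pair of its Lie bracket and its product.
\<close>

definition qcl ::
  "('k::field \<Rightarrow> 'a::ab_group_add \<Rightarrow> 'a) \<Rightarrow> ('a \<Rightarrow> 'a \<Rightarrow> 'a) \<Rightarrow>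
   ('a fps \<Rightarrow> 'a fps \<Rightarrow> 'a fps) \<Rightarrow> ('a \<Rightarrow> 'a \<Rightarrow> 'a) \<times> ('a \<Rightarrow> 'a \<Rightarrow> 'a)" where
  "qcl s mul mulh =
     ((\<lambda>x y. quot_h s (mulh (fps_const x) (fps_const y) - mulh (fps_const y) (fps_const x))), mul)"

definition matched_pair_deformation ::
  "('k::field \<Rightarrow> 'a::ab_group_add \<Rightarrow> 'a) \<Rightarrow> ('a \<Rightarrow> 'a \<Rightarrow> 'a) \<Rightarrow>
   ('k \<Rightarrow> 'b::ab_group_add \<Rightarrow> 'b) \<Rightarrow> ('b \<Rightarrow> 'b \<Rightarrow> 'b) \<Rightarrow>
   ('a \<Rightarrow> 'b \<Rightarrow> 'b) \<Rightarrow> ('a \<Rightarrow> 'b \<Rightarrow> 'b) \<Rightarrow> ('b \<Rightarrow> 'a \<Rightarrow> 'a) \<Rightarrow> ('b \<Rightarrow> 'a \<Rightarrow> 'a) \<Rightarrow>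
   ('a fps \<Rightarrow> 'a fps \<Rightarrow> 'a fps) \<Rightarrow> ('b fps \<Rightarrow> 'b fps \<Rightarrow> 'b fps) \<Rightarrow>
   ('a fps \<Rightarrow> 'b fps \<Rightarrow> 'b fps) \<Rightarrow> ('a fps \<Rightarrow> 'b fps \<Rightarrow> 'b fps) \<Rightarrow>
   ('b fps \<Rightarrow> 'a fps \<Rightarrow> 'a fps) \<Rightarrow> ('b fps \<Rightarrow> 'a fps \<Rightarrow> 'a fps) \<Rightarrow> bool" where
  "matched_pair_deformation sA mA sB mB lA rA lB rB mAh mBh lAh rAh lBh rBh \<longleftrightarrow>
     assoc_matched_pair sA mA sB mB lA rA lB rB \<and>
     assoc_matched_pair (fps_scale sA) mAh (fps_scale sB) mBh lAh rAh lBh rBh \<and>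
     assoc_deformation (module_prod.scale sA sB) (assoc_bowtie mA mB lA rA lB rB)
       (transport_pair (assoc_bowtie mAh mBh lAh rAh lBh rBh))"

definition matched_pair_qcl ::
  "('k::field \<Rightarrow> 'a::ab_group_add \<Rightarrow> 'a) \<Rightarrow> ('a \<Rightarrow> 'a \<Rightarrow> 'a) \<Rightarrow>
   ('k \<Rightarrow> 'b::ab_group_add \<Rightarrow> 'b) \<Rightarrow> ('b \<Rightarrow> 'b \<Rightarrow> 'b) \<Rightarrow>
   ('a \<Rightarrow> 'b \<Rightarrow> 'b) \<Rightarrow> ('b \<Rightarrow> 'a \<Rightarrow> 'a) \<Rightarrow>
   ('a fps \<Rightarrow> 'a fps \<Rightarrow> 'a fps) \<Rightarrow> ('b fps \<Rightarrow> 'b fps \<Rightarrow> 'b fps) \<Rightarrow>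
   ('a fps \<Rightarrow> 'b fps \<Rightarrow> 'b fps) \<Rightarrow> ('a fps \<Rightarrow> 'b fps \<Rightarrow> 'b fps) \<Rightarrow>
   ('b fps \<Rightarrow> 'a fps \<Rightarrow> 'a fps) \<Rightarrow> ('b fps \<Rightarrow> 'a fps \<Rightarrow> 'a fps) \<Rightarrow>
   (('a \<Rightarrow> 'a \<Rightarrow> 'a) \<times> ('a \<Rightarrow> 'a \<Rightarrow> 'a)) \<times> (('b \<Rightarrow> 'b \<Rightarrow> 'b) \<times> ('b \<Rightarrow> 'b \<Rightarrow> 'b)) \<times>
   ('a \<Rightarrow> 'b \<Rightarrow> 'b) \<times> ('a \<Rightarrow> 'b \<Rightarrow> 'b) \<times> ('b \<Rightarrow> 'a \<Rightarrow> 'a) \<times> ('b \<Rightarrow> 'a \<Rightarrow> 'a)" where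
  "matched_pair_qcl sA mA sB mB rhoA rhoB mAh mBh lAh rAh lBh rBh =
     (qcl sA mA mAh, qcl sB mB mBh,
      (\<lambda>x v. quot_h sB (lAh (fps_const x) (fps_const v) - rAh (fps_const x) (fps_const v))), rhoA,
      (\<lambda>v x. quot_h sA (lBh (fps_const v) (fps_const x) - rBh (fps_const v) (fps_const x))), rhoB)"

end

theory Submission
  imports Defs
begin

text \<open>
  The quasiclassical limit of a deformation of a commutative algebra is a Poisson algebra for the
  following reason. The commutator \<open>C f g\<close> of the deformed product is a Lie bracket on \<open>A[[h]]\<close>, and
  each \<open>C f\<close> is a derivation of the product. Commutativity modulo \<open>h\<close> makes \<open>C f g\<close> divisible by \<open>h\<close>,
  and since \<open>h\<close> is a nonzerodivisor the quotient \<open>C f g / h\<close> satisfies the Jacobi and Leibniz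
  identities as well. Modulo \<open>h\<close> it depends only on the constant terms of \<open>f\<close> and \<open>g\<close> (lemma
  \<open>commutator_nth_1\<close>) and is the bracket of the limit, so the identities descend to \<open>A\<close>. In terms of
  coefficients, the Leibniz rule is read off at \<open>h\<^sup>1\<close> and the Jacobi identity at \<open>h\<^sup>2\<close>; this is
  \<open>poisson_algebra_qcl\<close>.

  For a matched pair, the deformed product on \<open>(A \<times> B)[[h]]\<close> is a deformation of the commutative
  product on \<open>A \<times> B\<close>, so its limit is a Poisson algebra. Its commutator is computed componentwise:
  antisymmetrising turns each pair of left and right actions into their difference, and the
  coefficient of \<open>h\<close> is the Poisson bowtie built from the limit data. Restricting the congruence
  modulo \<open>h\<close> to the two summands shows that the factors are deformations too, and hence have Poisson
  limits, and that the differences of the actions are divisible by \<open>h\<close>, so that their limits exist.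
\<close>

section \<open>Bilinear maps on power series\<close>

lemma bilinear_mapD:
  assumes "bilinear_map s1 s2 s3 f"
  shows "f (x + x') y = f x y + f x' y" "f x (y + y') = f x y + f x y'"
    and "f (x - x') y = f x y - f x' y" "f x (y - y') = f x y - f x y'"
    and "f (s1 c x) y = s3 c (f x y)" "f x (s2 c y) = s3 c (f x y)"
    and "f 0 y = 0" "f x 0 = 0"
proof -
  interpret L: module_hom s1 s3 "\<lambda>x. f x y" using assms by (simp add: bilinear_map_def)
  interpret R: module_hom s2 s3 "f x" using assms by (simp add: bilinear_map_def)
  show "f (x + x') y = f x y + f x' y" "f x (y + y') = f x y + f x y'"
    and "f (x - x') y = f x y - f x' y" "f x (y - y') = f x y - f x y'"
    and "f (s1 c x) y = s3 c (f x y)" "f x (s2 c y) = s3 c (f x y)"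
    and "f 0 y = 0" "f x 0 = 0"
    by (rule L.add R.add L.diff R.diff L.scale R.scale L.zero R.zero)+
qed

lemma bilinear_mapI:
  assumes "module s1" "module s2" "module s3"
    and "\<And>x x' y. f (x + x') y = f x y + f x' y" "\<And>x y y'. f x (y + y') = f x y + f x y'"
    and "\<And>c x y. f (s1 c x) y = s3 c (f x y)" "\<And>c x y. f x (s2 c y) = s3 c (f x y)"
  shows "bilinear_map s1 s2 s3 f"
  using assms by (simp add: bilinear_map_def module_hom_def module_hom_axioms_def)

lemma bilinear_map_diff:
  assumes f: "bilinear_map s1 s2 s3 f" and g: "bilinear_map s1 s2 s3 g"
  shows "bilinear_map s1 s2 s3 (\<lambda>x y. f x y - g x y)"
proof -
  (* linearity of any partial map includes the module axioms, so an arbitrary argument will do *)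
  have "module_hom s1 s3 (\<lambda>x. f x undefined)" "module_hom s2 s3 (f undefined)"
    using f by (auto simp: bilinear_map_def)
  then have m: "module s1" "module s2" "module s3" by (auto simp: module_hom_def)
  then interpret s3: module s3 by simp
  show ?thesis
    by (intro bilinear_mapI m)
       (simp_all add: bilinear_mapD[OF f] bilinear_mapD[OF g] s3.scale_right_diff_distrib)
qed

lemma bilinear_map_swap:
  "bilinear_map s s t f \<Longrightarrow> bilinear_map s s t (\<lambda>x y. f y x)"
  by (simp add: bilinear_map_def)

lemma fps_nth_scale_const:
  assumes "module s"
  shows "fps_nth (fps_scale s (fps_const c) f) n = s c (fps_nth f n)"
proof -
  interpret module s by fact
  have "(\<Sum>i=0..n. s (fps_nth (fps_const c) i) (fps_nth f (n - i))) =
        (\<Sum>i=0..n. if i = 0 then s c (fps_nth f (n - i)) else 0)"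
    by (intro sum.cong refl) simp
  then show ?thesis by (simp add: fps_scale_def)
qed

lemma fps_const_scale:
  assumes "module s"
  shows "fps_const (s c x) = fps_scale s (fps_const c) (fps_const x)"
proof -
  interpret module s by fact
  show ?thesis by (rule fps_ext) (simp add: fps_nth_scale_const[OF assms])
qed

text \<open>
  The coefficients of a \<open>k[[h]]\<close>-bilinear map on constant series are \<open>k\<close>-bilinear; the Lie
  brackets and Lie actions of a quasiclassical limit arise in this way, with \<open>n = 1\<close>, from
  commutators and from differences of left and right actions.
\<close>

lemma bilinear_map_coefficient:
  assumes F: "bilinear_map (fps_scale s1) (fps_scale s2) (fps_scale s3) F"
    and m: "module s1" "module s2" "module s3"
  shows "bilinear_map s1 s2 s3 (\<lambda>x y. fps_nth (F (fps_const x) (fps_const y)) n)"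
  by (intro bilinear_mapI m)
     (simp_all add: bilinear_mapD[OF F] fps_const_scale m fps_nth_scale_const
        flip: fps_const_add)

lemma fps_decompose_const:
  assumes "module s"
  shows "f = fps_const (fps_nth f 0) + fps_scale s fps_X (fps_shift 1 f)"
  by (rule fps_ext) (simp add: fps_scale_X_nth[OF assms])

lemma fps_divisible_h:
  assumes "module s" and "fps_nth f 0 = 0"
  shows "f = fps_scale s fps_X (fps_shift 1 f)"
  using fps_decompose_const[OF assms(1), of f] assms(2) by simp


section \<open>The quasiclassical limit is a Poisson algebra\<close>

locale commutative_deformation =
  comm_assoc_algebra s mul
  for s :: "'k::field \<Rightarrow> 'a::ab_group_add \<Rightarrow> 'a" and mul +
  fixes mulh :: "'a fps \<Rightarrow> 'a fps \<Rightarrow> 'a fps"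
  assumes deformation: "assoc_deformation s mul mulh"
begin

sublocale deformed: assoc_algebra "fps_scale s" mulh
  using deformation by (simp add: assoc_deformation_def)

definition commutator :: "'a fps \<Rightarrow> 'a fps \<Rightarrow> 'a fps" where
  "commutator f g = mulh f g - mulh g f"

definition bracket :: "'a \<Rightarrow> 'a \<Rightarrow> 'a" where
  "bracket x y = fps_nth (commutator (fps_const x) (fps_const y)) 1"

lemmas mulh_simps = bilinear_mapD[OF deformed.mul_bilinear]

lemma commutator_bilinear:
  "bilinear_map (fps_scale s) (fps_scale s) (fps_scale s) commutator"
  unfolding commutator_def
  by (intro bilinear_map_diff bilinear_map_swap[of _ _ mulh] deformed.mul_bilinear)

lemmas commutator_simps = bilinear_mapD[OF commutator_bilinear]

lemma scale_X_nth [simp]: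
  "fps_nth (fps_scale s fps_X f) 0 = 0"
  "fps_nth (fps_scale s fps_X f) (Suc n) = fps_nth f n"
  by (simp_all add: fps_scale_X_nth[OF module_axioms])

lemma mulh_nth_0: "fps_nth (mulh f g) 0 = mul (fps_nth f 0) (fps_nth g 0)"
proof -
  have const: "fps_nth (mulh (fps_const x) (fps_const y)) 0 = mul x y" for x y
    using deformation by (simp add: assoc_deformation_def cong_h_iff[OF module_axioms])
  show ?thesis
    by (subst fps_decompose_const[OF module_axioms, of f],
        subst fps_decompose_const[OF module_axioms, of g])
       (simp add: mulh_simps const)
qed

lemma commutator_nth_0 [simp]: "fps_nth (commutator f g) 0 = 0"
  by (simp add: commutator_def mulh_nth_0 mul_comm)

text \<open>
  Changing \<open>f\<close> by a multiple of \<open>h\<close> changes the commutator by \<open>h\<close> times a commutator, that is by a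
  multiple of \<open>h\<^sup>2\<close>.
\<close>

lemma commutator_nth_1: "fps_nth (commutator f g) 1 = bracket (fps_nth f 0) (fps_nth g 0)"
  by (subst fps_decompose_const[OF module_axioms, of f],
      subst fps_decompose_const[OF module_axioms, of g])
     (simp add: commutator_simps bracket_def)

definition divided_commutator :: "'a fps \<Rightarrow> 'a fps \<Rightarrow> 'a fps" where
  "divided_commutator f g = fps_shift 1 (commutator f g)"

lemma commutator_eq: "commutator f g = fps_scale s fps_X (divided_commutator f g)"
  unfolding divided_commutator_def by (rule fps_divisible_h[OF module_axioms]) simp

lemma divided_commutator_nth_0:
  "fps_nth (divided_commutator f g) 0 = bracket (fps_nth f 0) (fps_nth g 0)"
  using commutator_nth_1[of f g] by (simp add: divided_commutator_def)

lemma commutator_jacobi: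
  "commutator x (commutator y z) + commutator y (commutator z x) +
   commutator z (commutator x y) = 0"
  by (simp add: commutator_def mulh_simps deformed.mul_assoc)

lemma commutator_derivation:
  "commutator x (mulh y z) = mulh (commutator x y) z + mulh y (commutator x z)"
  by (simp add: commutator_def mulh_simps deformed.mul_assoc)

lemma bracket_bilinear: "bilinear_map s s s bracket"
  unfolding bracket_def
  by (rule bilinear_map_coefficient[OF commutator_bilinear module_axioms module_axioms module_axioms])

lemma bracket_jacobi:
  "bracket x (bracket y z) + bracket y (bracket z x) + bracket z (bracket x y) = 0"
proof -
  (* one factor h comes out of the inner commutator and the second one out of the outer *)
  have iterated: "fps_nth (commutator (fps_const x) (commutator (fps_const y) (fps_const z))) 2 =
      bracket x (bracket y z)" for x y z
  proof -
    have "fps_nth (commutator (fps_const x) (commutator (fps_const y) (fps_const z))) 2 =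
        fps_nth (commutator (fps_const x) (divided_commutator (fps_const y) (fps_const z))) 1"
      by (simp add: commutator_eq[of "fps_const y"] commutator_simps numeral_2_eq_2)
    then show ?thesis by (simp only: commutator_nth_1 divided_commutator_nth_0 fps_nth_fps_const simp_thms if_True)
  qed
  show ?thesis
    using arg_cong[OF commutator_jacobi[of "fps_const x" "fps_const y" "fps_const z"],
        of "\<lambda>f. fps_nth f 2"]
    by (simp add: iterated)
qed

lemma bracket_leibniz: "bracket x (mul y z) = mul (bracket x y) z + mul y (bracket x z)"
proof -
  let ?x = "fps_const x" and ?y = "fps_const y" and ?z = "fps_const z"
  have "fps_nth (commutator ?x (mulh ?y ?z)) 1 =
      fps_nth (mulh (divided_commutator ?x ?y) ?z + mulh ?y (divided_commutator ?x ?z)) 0"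
    by (simp add: commutator_derivation commutator_eq[of ?x ?y] commutator_eq[of ?x ?z] mulh_simps)
  then show ?thesis
    by (simp only: commutator_nth_1 mulh_nth_0 divided_commutator_nth_0 fps_add_nth
        fps_nth_fps_const simp_thms if_True)
qed

lemma qcl_eq: "qcl s mul mulh = (bracket, mul)"
  by (simp add: qcl_def fun_eq_iff bracket_def quot_h_eq[OF module_axioms] flip: commutator_def)

lemma poisson_algebra_qcl: "poisson_algebra s bracket mul"
proof unfold_locales
  show "bracket x x = 0" for x by (simp add: bracket_def commutator_def)
qed (rule bracket_bilinear bracket_jacobi bracket_leibniz)+

end


section \<open>Matched pair deformations\<close>

lemma fps_nth_transport_bowtie:
  "fps_nth (transport_pair (assoc_bowtie mA mB lA rA lB rB) (fps_const (x, u)) (fps_const (y, v))) n =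
     (fps_nth (mA (fps_const x) (fps_const y) + lB (fps_const u) (fps_const y) +
        rB (fps_const v) (fps_const x)) n,
      fps_nth (lA (fps_const x) (fps_const v) + rA (fps_const y) (fps_const u) +
        mB (fps_const u) (fps_const v)) n)"
proof -
  have "fps_unpair (fps_const (a, b)) = (fps_const a, fps_const b)"
    for a :: 'a and b :: 'b
    by (auto simp: fps_unpair_def fps_eq_iff zero_prod_def)
  then show ?thesis by (simp add: transport_pair_def assoc_bowtie_def fps_pair_def)
qed

text \<open>
  The congruence on \<open>(A \<times> B)[[h]]\<close>, evaluated on elements of the two summands, gives one congruence
  for each of the products and actions.
\<close>

lemma matched_pair_deformation_nth_0:
  assumes "matched_pair_deformation sA mA sB mB lA rA lB rB mAh mBh lAh rAh lBh rBh"
  shows "fps_nth (mAh (fps_const x) (fps_const y)) 0 = mA x y"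
    and "fps_nth (mBh (fps_const u) (fps_const v)) 0 = mB u v"
    and "fps_nth (lAh (fps_const x) (fps_const v)) 0 = lA x v"
    and "fps_nth (rAh (fps_const x) (fps_const v)) 0 = rA x v"
    and "fps_nth (lBh (fps_const u) (fps_const y)) 0 = lB u y"
    and "fps_nth (rBh (fps_const u) (fps_const y)) 0 = rB u y"
proof -
  let ?s = "module_prod.scale sA sB"
  have pair: "assoc_matched_pair sA mA sB mB lA rA lB rB"
    and pairh: "assoc_matched_pair (fps_scale sA) mAh (fps_scale sB) mBh lAh rAh lBh rBh"
    and deform: "assoc_deformation ?s (assoc_bowtie mA mB lA rA lB rB)
      (transport_pair (assoc_bowtie mAh mBh lAh rAh lBh rBh))"
    using assms by (simp_all add: matched_pair_deformation_def)
  have "module ?s" using deform by (simp add: assoc_deformation_def assoc_algebra_def)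
  with deform have congruence:
    "fps_nth (transport_pair (assoc_bowtie mAh mBh lAh rAh lBh rBh)
       (fps_const (x, u)) (fps_const (y, v))) 0 = assoc_bowtie mA mB lA rA lB rB (x, u) (y, v)"
    for x u y v
    by (simp add: assoc_deformation_def cong_h_iff)
  have bil: "bilinear_map sA sA sA mA" "bilinear_map sB sB sB mB"
      "bilinear_map sA sB sB lA" "bilinear_map sA sB sB rA"
      "bilinear_map sB sA sA lB" "bilinear_map sB sA sA rB"
    using pair by (simp_all add: assoc_matched_pair_def assoc_algebra_def assoc_algebra_axioms_def)
  have bilh: "bilinear_map (fps_scale sA) (fps_scale sA) (fps_scale sA) mAh"
      "bilinear_map (fps_scale sB) (fps_scale sB) (fps_scale sB) mBh"
      "bilinear_map (fps_scale sA) (fps_scale sB) (fps_scale sB) lAh"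
      "bilinear_map (fps_scale sA) (fps_scale sB) (fps_scale sB) rAh"
      "bilinear_map (fps_scale sB) (fps_scale sA) (fps_scale sA) lBh"
      "bilinear_map (fps_scale sB) (fps_scale sA) (fps_scale sA) rBh"
    using pairh by (simp_all add: assoc_matched_pair_def assoc_algebra_def assoc_algebra_axioms_def)
  note zero = bil[THEN bilinear_mapD(7)] bil[THEN bilinear_mapD(8)]
    bilh[THEN bilinear_mapD(7)] bilh[THEN bilinear_mapD(8)]
  note expand = assoc_bowtie_def zero
  show "fps_nth (mAh (fps_const x) (fps_const y)) 0 = mA x y"
    using congruence[of x 0 y 0, unfolded fps_nth_transport_bowtie] by (simp add: expand)
  show "fps_nth (mBh (fps_const u) (fps_const v)) 0 = mB u v"
    using congruence[of 0 u 0 v, unfolded fps_nth_transport_bowtie] by (simp add: expand)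
  show "fps_nth (lAh (fps_const x) (fps_const v)) 0 = lA x v"
    using congruence[of x 0 0 v, unfolded fps_nth_transport_bowtie] by (simp add: expand)
  show "fps_nth (rAh (fps_const x) (fps_const v)) 0 = rA x v"
    using congruence[of 0 v x 0, unfolded fps_nth_transport_bowtie] by (simp add: expand)
  show "fps_nth (lBh (fps_const u) (fps_const y)) 0 = lB u y"
    using congruence[of 0 u y 0, unfolded fps_nth_transport_bowtie] by (simp add: expand)
  show "fps_nth (rBh (fps_const u) (fps_const y)) 0 = rB u y"
    using congruence[of y 0 0 u, unfolded fps_nth_transport_bowtie] by (simp add: expand)
qed

theorem theorem3p8:
  fixes sA :: "'k::field_char_0 \<Rightarrow> 'a::ab_group_add \<Rightarrow> 'a"
    and sB :: "'k \<Rightarrow> 'b::ab_group_add \<Rightarrow> 'b"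
    and mA brA :: "'a \<Rightarrow> 'a \<Rightarrow> 'a" and mB brB :: "'b \<Rightarrow> 'b \<Rightarrow> 'b"
    and rhoA rho_brA :: "'a \<Rightarrow> 'b \<Rightarrow> 'b" and rhoB rho_brB :: "'b \<Rightarrow> 'a \<Rightarrow> 'a"
    and mAh :: "'a fps \<Rightarrow> 'a fps \<Rightarrow> 'a fps" and mBh :: "'b fps \<Rightarrow> 'b fps \<Rightarrow> 'b fps"
    and lAh rAh :: "'a fps \<Rightarrow> 'b fps \<Rightarrow> 'b fps" and lBh rBh :: "'b fps \<Rightarrow> 'a fps \<Rightarrow> 'a fps"
  assumes "comm_matched_pair sA mA sB mB rhoA rhoB"
    and "matched_pair_deformation sA mA sB mB rhoA rhoA rhoB rhoB mAh mBh lAh rAh lBh rBh"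
    and "((brA, mA), (brB, mB), rho_brA, rhoA, rho_brB, rhoB) =
           matched_pair_qcl sA mA sB mB rhoA rhoB mAh mBh lAh rAh lBh rBh"
  shows "poisson_matched_pair sA brA mA sB brB mB rho_brA rhoA rho_brB rhoB \<and>
         qcl (module_prod.scale sA sB) (assoc_bowtie mA mB rhoA rhoA rhoB rhoB)
           (transport_pair (assoc_bowtie mAh mBh lAh rAh lBh rBh)) =
         poisson_bowtie brA mA brB mB rho_brA rhoA rho_brB rhoB"
proof -
  let ?s = "module_prod.scale sA sB"
  let ?m = "assoc_bowtie mA mB rhoA rhoA rhoB rhoB"
  let ?mh = "transport_pair (assoc_bowtie mAh mBh lAh rAh lBh rBh)"
  note const_0 = matched_pair_deformation_nth_0[OF assms(2)]
  have pair: "assoc_matched_pair sA mA sB mB rhoA rhoA rhoB rhoB"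
    and commA: "comm_assoc_algebra sA mA" and commB: "comm_assoc_algebra sB mB"
    and comm: "comm_assoc_algebra ?s ?m"
    using assms(1) by (simp_all add: comm_matched_pair_def)
  have pairh: "assoc_matched_pair (fps_scale sA) mAh (fps_scale sB) mBh lAh rAh lBh rBh"
    and deform: "assoc_deformation ?s ?m ?mh"
    using assms(2) by (simp_all add: matched_pair_deformation_def)
  have algA: "assoc_algebra sA mA" and algB: "assoc_algebra sB mB"
    using pair by (simp_all add: assoc_matched_pair_def)
  then have mA: "module sA" and mB: "module sB" by (simp_all add: assoc_algebra_def)
  have "assoc_deformation sA mA mAh" "assoc_deformation sB mB mBh"
    using algA algB pairh
    by (simp_all add: assoc_deformation_def assoc_matched_pair_def cong_h_iff mA mB const_0)
  then interpret A: commutative_deformation sA mA mAh + B: commutative_deformation sB mB mBh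
    using commA commB
    by (simp_all add: commutative_deformation_def commutative_deformation_axioms_def)
  interpret AB: commutative_deformation ?s ?m ?mh
    using comm deform by (simp add: commutative_deformation_def commutative_deformation_axioms_def)

  have brA: "brA = A.bracket" and brB: "brB = B.bracket"
    using assms(3) by (simp_all add: matched_pair_qcl_def A.qcl_eq B.qcl_eq)
  have rho_brA: "rho_brA = (\<lambda>x v. fps_nth (lAh (fps_const x) (fps_const v) -
      rAh (fps_const x) (fps_const v)) 1)"
    and rho_brB: "rho_brB = (\<lambda>v x. fps_nth (lBh (fps_const v) (fps_const x) -
      rBh (fps_const v) (fps_const x)) 1)"
    using assms(3) by (simp_all add: matched_pair_qcl_def quot_h_eq mA mB const_0)

  have bil_brA: "bilinear_map sA sB sB rho_brA" and bil_brB: "bilinear_map sB sA sA rho_brB"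
    using pairh unfolding rho_brA rho_brB assoc_matched_pair_def
    by (auto intro!: bilinear_map_coefficient bilinear_map_diff mA mB)

  have "AB.bracket (x, u) (y, v) =
      (brA x y + rho_brB u y - rho_brB v x, rho_brA x v - rho_brA y u + brB u v)" for x u y v
    by (simp add: AB.bracket_def AB.commutator_def fps_nth_transport_bowtie brA brB rho_brA rho_brB
        A.bracket_def A.commutator_def B.bracket_def B.commutator_def)
  then have bowtie: "poisson_bowtie brA mA brB mB rho_brA rhoA rho_brB rhoB = (AB.bracket, ?m)"
    by (auto simp: poisson_bowtie_def assoc_bowtie_def fun_eq_iff)

  have "poisson_matched_pair sA brA mA sB brB mB rho_brA rhoA rho_brB rhoB"
    using pair bil_brA bil_brB A.poisson_algebra_qcl B.poisson_algebra_qcl AB.poisson_algebra_qcl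
    by (simp add: poisson_matched_pair_def bowtie assoc_matched_pair_def flip: brA brB)
  then show ?thesis by (simp add: bowtie AB.qcl_eq)
qed

end
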